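(* For $n\ge 1$, the complex symmetric pairs $(\mathrm{SL}_{2n+1},\mathrm{SO}_{2n+1})$ and $(\mathrm{SL}_{2n},\mathrm{Sp}_{2n})$ are pleasant, whereas the pair $(\mathrm{SL}_{2n},\mathrm{SO}_{2n})$ is not pleasant. For $p,q\geq 1$, the pair $(\mathrm{SL}_{p+q},\mathrm{S}(\mathrm{GL}_p\times\mathrm{GL}_q))$ is pleasant if and only if $p\neq q$.
   Context: All groups are complex. A symmetric pair $(G,H,\theta)$ has $H=G^\theta$ for an involution $\theta$ of $G$. Let $\mathrm{Ad}:G\to\mathrm{Aut}\,G$ be the action by conjugation and $\mathcal{A}_\theta=\{g\in G\mid\theta(g)\in gZ(G)\}$. The pair is pleasant if $\mathrm{Ad}\,\mathcal{A}_\theta\subseteq\mathrm{Ad}\,H$. The involutions are: $\theta(g)=(g^{\intercal})^{-1}$ for $(\mathrm{SL}_m,\mathrm{SO}_m)$; $\theta(g)=J(g^{\intercal})^{-1}J^{-1}$ with $J=\begin{pmatrix} 0 & -I_n \\ I_n & 0 \end{pmatrix}$ for $(\mathrm{SL}_{2n},\mathrm{Sp}_{2n})$; and conjugation by $I_{p,q}=\begin{pmatrix} I_p & 0 \\ 0 & -I_q \end{pmatrix}$ for $(\mathrm{SL}_{p+q},\mathrm{S}(\mathrm{GL}_p\times\mathrm{GL}_q))$. *)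

theory Defs
  imports
    Complex_Main
    "HOL-Algebra.Coset"
    "Jordan_Normal_Form.Determinant"
begin

(* Involutions are only required to square to the identity: the involution of
   (SL_2, Sp_2) is the identity map. *)
definition is_involution :: "('a, 'b) monoid_scheme \<Rightarrow> ('a \<Rightarrow> 'a) \<Rightarrow> bool" where
  "is_involution G \<theta> \<longleftrightarrow> \<theta> \<in> iso G G \<and> (\<forall>g \<in> carrier G. \<theta> (\<theta> g) = g)"

(* Only the underlying abstract groups are recorded; pleasantness does not involve
   the structure of an algebraic group. *)
definition symmetric_pair ::
    "('a, 'b) monoid_scheme \<Rightarrow> 'a set \<Rightarrow> ('a \<Rightarrow> 'a) \<Rightarrow> bool" where
  "symmetric_pair G H \<theta> \<longleftrightarrow>
     group G \<and> is_involution G \<theta> \<and> H = {g \<in> carrier G. \<theta> g = g}"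

definition group_center :: "('a, 'b) monoid_scheme \<Rightarrow> 'a set" where
  "group_center G = {z \<in> carrier G. \<forall>g \<in> carrier G. z \<otimes>\<^bsub>G\<^esub> g = g \<otimes>\<^bsub>G\<^esub> z}"

(* Restricted to the carrier, so that equality of maps is equality of automorphisms of G. *)
definition Ad :: "('a, 'b) monoid_scheme \<Rightarrow> 'a \<Rightarrow> ('a \<Rightarrow> 'a)" where
  "Ad G g = (\<lambda>x \<in> carrier G. g \<otimes>\<^bsub>G\<^esub> x \<otimes>\<^bsub>G\<^esub> inv\<^bsub>G\<^esub> g)"

definition A_theta :: "('a, 'b) monoid_scheme \<Rightarrow> ('a \<Rightarrow> 'a) \<Rightarrow> 'a set" where
  "A_theta G \<theta> = {g \<in> carrier G. \<theta> g \<in> g <#\<^bsub>G\<^esub> group_center G}"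

definition pleasant ::
    "('a, 'b) monoid_scheme \<Rightarrow> 'a set \<Rightarrow> ('a \<Rightarrow> 'a) \<Rightarrow> bool" where
  "pleasant G H \<theta> \<longleftrightarrow> Ad G ` A_theta G \<theta> \<subseteq> Ad G ` H"

definition GL :: "nat \<Rightarrow> complex mat monoid" where
  "GL m = units_of (ring_mat TYPE(complex) m ())"

definition SL :: "nat \<Rightarrow> complex mat monoid" where
  "SL m = (GL m)\<lparr>carrier := {g \<in> carrier (GL m). det g = 1}\<rparr>"

definition SO :: "nat \<Rightarrow> complex mat set" where
  "SO m = {g \<in> carrier_mat m m. transpose_mat g * g = 1\<^sub>m m \<and> det g = 1}"

definition J_mat :: "nat \<Rightarrow> complex mat" where
  "J_mat n = four_block_mat (0\<^sub>m n n) (- 1\<^sub>m n) (1\<^sub>m n) (0\<^sub>m n n)"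

(* Indexed by the rank n: Sp n consists of 2n x 2n matrices.  That these have
   determinant 1 is a theorem, not part of the definition. *)
definition Sp :: "nat \<Rightarrow> complex mat set" where
  "Sp n = {g \<in> carrier_mat (2 * n) (2 * n). transpose_mat g * J_mat n * g = J_mat n}"

definition I_mat :: "nat \<Rightarrow> nat \<Rightarrow> complex mat" where
  "I_mat p q = four_block_mat (1\<^sub>m p) (0\<^sub>m p q) (0\<^sub>m q p) (- 1\<^sub>m q)"

definition S_GL_GL :: "nat \<Rightarrow> nat \<Rightarrow> complex mat set" where
  "S_GL_GL p q =
     {four_block_mat a (0\<^sub>m p q) (0\<^sub>m q p) b | a b.
        a \<in> carrier (GL p) \<and> b \<in> carrier (GL q) \<and> det a * det b = 1}"

(* Matrix inverses are taken in GL, since I_mat p q need not have determinant 1. *)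
definition theta_SO :: "nat \<Rightarrow> complex mat \<Rightarrow> complex mat" where
  "theta_SO m g = inv\<^bsub>GL m\<^esub> (transpose_mat g)"

definition theta_Sp :: "nat \<Rightarrow> complex mat \<Rightarrow> complex mat" where
  "theta_Sp n g =
     J_mat n * inv\<^bsub>GL (2 * n)\<^esub> (transpose_mat g) * inv\<^bsub>GL (2 * n)\<^esub> (J_mat n)"

definition theta_GL_GL :: "nat \<Rightarrow> nat \<Rightarrow> complex mat \<Rightarrow> complex mat" where
  "theta_GL_GL p q g = I_mat p q * g * inv\<^bsub>GL (p + q)\<^esub> (I_mat p q)"

end

theory Submission
  imports Defs
begin

text \<open>
  The centre of \<open>SL\<^sub>m\<close> consists of the scalars \<open>c\<close> with \<open>c\<^sup>m = 1\<close>, and \<open>Ad g = Ad h\<close> means that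
  \<open>g\<close> and \<open>h\<close> differ by a central element. So pleasantness asks whether every \<open>g\<close> with \<open>\<theta>(g) = c g\<close>
  has a multiple \<open>d g\<close> in \<open>H\<close> with \<open>d\<^sup>m = 1\<close>. For \<open>SO\<close> and \<open>Sp\<close> this forces \<open>d\<^sup>2 = c\<close>: an \<open>m\<close>-th root
  of unity has a square root of that kind if \<open>m\<close> is odd; for \<open>m = 2n\<close> and \<open>SO\<close>, the matrix
  \<open>e\<^bsup>\<pi>i/m\<^esup> diag(-1, 1, \<dots>, 1)\<close> is an obstruction; for \<open>Sp\<close>, any square root \<open>d\<close> makes \<open>d g\<close> symplectic,
  and \<open>d\<^sup>m = det (d g) = 1\<close> because symplectic matrices have determinant 1.
  For \<open>\<theta> = Ad I\<^bsub>p,q\<^esub>\<close>, the relation \<open>g I g\<^sup>-\<^sup>1 = c I\<close> and the trace \<open>p - q\<close> of \<open>I\<close> give \<open>c = 1\<close> if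
  \<open>p \<noteq> q\<close>, whereas \<open>\<theta>(J) = -J\<close> if \<open>p = q\<close>.
\<close>

subsection \<open>Isometries of nondegenerate alternating forms\<close>

text \<open>From \<open>g^T J g = J\<close> one gets
  \<open>g^T J (1 + g) = g^T J + J = (1 + g)^T J\<close>. Taking determinants, the nonzero factors
  \<open>det J\<close> and \<open>det (1 + g)\<close> cancel.\<close>

lemma det_isometry_if_add_one_nonsingular:
  fixes g J :: "'a::field mat"
  assumes J: "J \<in> carrier_mat m m" "det J \<noteq> 0" and g: "g \<in> carrier_mat m m"
    and eq: "transpose_mat g * J * g = J" and nz: "det (1\<^sub>m m + g) \<noteq> 0"
  shows "det g = 1"
proof -
  have "transpose_mat g * J * (1\<^sub>m m + g) = transpose_mat g * J + J"
    using J g eq by (simp add: mult_add_distrib_mat[of _ m m _ m] assoc_mult_mat[of _ m m _ m _ m])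
  also have "\<dots> = transpose_mat (1\<^sub>m m + g) * J"
    using J g by (simp add: transpose_add[of _ m m] add_mult_distrib_mat[of _ m m _ _ m] comm_add_mat[of _ m m])
  finally have "det (transpose_mat g * J * (1\<^sub>m m + g)) = det (transpose_mat (1\<^sub>m m + g) * J)"
    by simp
  then show ?thesis
    using J g nz by (simp add: det_mult[of _ m] det_transpose[of _ m])
qed

text \<open>The rank-one matrix \<open>v v^T\<close>; with it, \<open>1 - outer v * J\<close> is the
  transvection sending \<open>x\<close> to \<open>x - (v^T J x) v\<close>.\<close>

definition outer :: "'a::semiring_0 vec \<Rightarrow> 'a mat" where
  "outer v = mat (dim_vec v) (dim_vec v) (\<lambda>(i, j). v $ i * v $ j)"

lemma outer_carrier: "v \<in> carrier_vec m \<Longrightarrow> outer v \<in> carrier_mat m m"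
  by (simp add: outer_def)

lemma transpose_outer: "transpose_mat (outer v) = outer (v :: 'a::comm_semiring_0 vec)"
  by (rule eq_matI) (simp_all add: outer_def mult.commute)

lemma row_outer: "i < dim_vec v \<Longrightarrow> row (outer v) i = v $ i \<cdot>\<^sub>v v"
  by (rule eq_vecI) (simp_all add: outer_def)

lemma col_outer: "j < dim_vec v \<Longrightarrow> col (outer v) j = v $ j \<cdot>\<^sub>v (v :: 'a::comm_semiring_0 vec)"
  by (rule eq_vecI) (simp_all add: outer_def mult.commute)

lemma outer_mult_vec:
  fixes v :: "'a::comm_semiring_0 vec"
  assumes "v \<in> carrier_vec m" "y \<in> carrier_vec m"
  shows "outer v *\<^sub>v y = (v \<bullet> y) \<cdot>\<^sub>v v"
  using assms by (intro eq_vecI) (auto simp: outer_def scalar_prod_def sum_distrib_left ac_simps)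

lemma skew_form_swap:
  fixes J :: "'a::comm_ring_1 mat"
  assumes J: "J \<in> carrier_mat m m" "transpose_mat J = - J"
    and x: "x \<in> carrier_vec m" and y: "y \<in> carrier_vec m"
  shows "x \<bullet> (J *\<^sub>v y) = - (y \<bullet> (J *\<^sub>v x))"
proof -
  have "x \<bullet> (J *\<^sub>v y) = (transpose_mat J *\<^sub>v x) \<bullet> y"
    using transpose_vec_mult_scalar[OF J(1) y x] by simp
  also have "\<dots> = - ((J *\<^sub>v x) \<bullet> y)"
    using J x y by simp
  also have "\<dots> = - (y \<bullet> (J *\<^sub>v x))"
    using J x y by (simp add: comm_scalar_prod[of y m])
  finally show ?thesis .
qed

text \<open>Each entry of the product contains the factor \<open>v^T J v\<close>, which equals its
  own negative because \<open>J\<close> is skew, and hence vanishes as 2 is nonzero.\<close>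

lemma outer_form_outer:
  fixes J :: "'a::field mat"
  assumes two: "(2::'a) \<noteq> 0"
    and J: "J \<in> carrier_mat m m" "transpose_mat J = - J" and v: "v \<in> carrier_vec m"
  shows "outer v * J * outer v = 0\<^sub>m m m"
proof -
  have "v \<bullet> (J *\<^sub>v v) = - (v \<bullet> (J *\<^sub>v v))"
    by (rule skew_form_swap[OF J v v])
  then have "2 * (v \<bullet> (J *\<^sub>v v)) = 0"
    by (metis add.right_inverse mult_2)
  then have iso: "v \<bullet> (J *\<^sub>v v) = 0"
    using two by simp
  have c: "outer v \<in> carrier_mat m m"
    using v by (rule outer_carrier)
  have "outer v * (J * outer v) = 0\<^sub>m m m"
  proof (rule eq_matI)
    fix i j assume ij: "i < dim_row (0\<^sub>m m m :: 'a mat)" "j < dim_col (0\<^sub>m m m :: 'a mat)"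
    have "(outer v * (J * outer v)) $$ (i, j) = row (outer v) i \<bullet> (J *\<^sub>v col (outer v) j)"
      using ij c J by (simp add: col_mult2[of _ m m])
    also have "\<dots> = 0"
      using ij v J iso by (simp add: row_outer col_outer mult_mat_vec[of _ m m])
    finally show "(outer v * (J * outer v)) $$ (i, j) = 0\<^sub>m m m $$ (i, j)"
      using ij by simp
  qed (use c J in auto)
  then show ?thesis
    using c J by (simp add: assoc_mult_mat[of _ m m _ m _ m])
qed

text \<open>Put \<open>P = outer v\<close>. As \<open>P\<close> is symmetric and \<open>J\<close>
  skew, the transpose of \<open>1 - P J\<close> is \<open>1 + J P\<close>. In
  \<open>(1 + J P) J (1 - P J)\<close> the two terms \<open>J P J\<close> cancel, and the quadratic
  term \<open>J (P J P) J\<close> is zero.\<close>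

lemma transvection_preserves_form:
  fixes J :: "'a::field mat"
  assumes two: "(2::'a) \<noteq> 0"
    and J: "J \<in> carrier_mat m m" "transpose_mat J = - J" and v: "v \<in> carrier_vec m"
  defines "T \<equiv> 1\<^sub>m m - outer v * J"
  shows "transpose_mat T * J * T = J"
proof -
  define P where "P = outer v"
  have P: "P \<in> carrier_mat m m" "transpose_mat P = P" and PJP: "P * J * P = 0\<^sub>m m m"
    using outer_carrier[OF v] outer_form_outer[OF two J v] by (auto simp: P_def transpose_outer)
  have tT: "transpose_mat T = 1\<^sub>m m + J * P"
    using J P by (simp add: T_def P_def[symmetric] transpose_minus[of _ m m] transpose_mult[of _ m m _ m])
      (intro eq_matI, auto)
  have "J * P * J * P * J = J * (P * J * P) * J"
    using J P by (simp add: assoc_mult_mat[of _ m m _ m _ m])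
  also have "\<dots> = 0\<^sub>m m m"
    using J by (simp add: PJP)
  finally have z: "J * P * J * P * J = 0\<^sub>m m m" .
  have "transpose_mat T * J * T = (J + J * P * J) * (1\<^sub>m m - P * J)"
    using J P tT by (simp add: T_def P_def[symmetric] add_mult_distrib_mat[of _ m m _ _ m])
  also have "\<dots> = (J + J * P * J) - (J * P * J + J * P * J * P * J)"
    using J P by (simp add: mult_minus_distrib_mat[of _ m m _ m] add_mult_distrib_mat[of _ m m _ _ m] assoc_mult_mat[of _ m m _ m _ m])
  also have "\<dots> = J"
    unfolding z using J P by (intro eq_matI) auto
  finally show ?thesis .
qed

text \<open>The matrix \<open>N = outer v * J\<close> squares to zero, so
  \<open>(c + N) (c - N) = c^2\<close>. The scalar is left free for two uses: \<open>c = 1\<close>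
  inverts the transvection, and \<open>c = 2\<close> shows that 1 plus the transvection is
  nonsingular.\<close>

lemma transvection_inverse:
  fixes J :: "'a::field mat"
  assumes two: "(2::'a) \<noteq> 0"
    and J: "J \<in> carrier_mat m m" "transpose_mat J = - J" and v: "v \<in> carrier_vec m"
  shows "(c \<cdot>\<^sub>m 1\<^sub>m m + outer v * J) * (c \<cdot>\<^sub>m 1\<^sub>m m - outer v * J) = (c * c) \<cdot>\<^sub>m 1\<^sub>m m"
proof -
  define N where "N = outer v * J"
  have N: "N \<in> carrier_mat m m"
    using outer_carrier[OF v] J by (simp add: N_def)
  have "N * N = outer v * J * outer v * J"
    using J outer_carrier[OF v] by (simp add: N_def assoc_mult_mat[of _ m m _ m _ m])
  then have NN: "N * N = 0\<^sub>m m m"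
    using J by (simp add: outer_form_outer[OF two J v])
  have "(c \<cdot>\<^sub>m 1\<^sub>m m + N) * (c \<cdot>\<^sub>m 1\<^sub>m m - N) = (c * c) \<cdot>\<^sub>m 1\<^sub>m m + c \<cdot>\<^sub>m N - (c \<cdot>\<^sub>m N + N * N)"
    using N by (simp add: mult_minus_distrib_mat[of _ m m _ m] add_mult_distrib_mat[of _ m m _ _ m]
        mult_smult_distrib[of _ m m _ m] mult_smult_assoc_mat[of _ m m _ m] add_smult_distrib_left_mat[of _ m m])
      (intro eq_matI, auto simp: algebra_simps)
  also have "\<dots> = (c * c) \<cdot>\<^sub>m 1\<^sub>m m"
    unfolding NN using N by (intro eq_matI) auto
  finally show ?thesis by (simp add: N_def)
qed

text \<open>The transvection \<open>T\<close> is itself an isometry, and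
  \<open>1 + T = 2 - N\<close> with \<open>N = outer v * J\<close> is nonsingular, being a factor of
  the scalar matrix 4. So the determinant argument for isometries with \<open>1 + g\<close>
  nonsingular applies to \<open>T\<close>.\<close>

lemma det_transvection:
  fixes J :: "'a::field mat"
  assumes two: "(2::'a) \<noteq> 0"
    and J: "J \<in> carrier_mat m m" "transpose_mat J = - J" "det J \<noteq> 0" and v: "v \<in> carrier_vec m"
  shows "det (1\<^sub>m m - outer v * J) = 1"
proof (rule det_isometry_if_add_one_nonsingular[OF J(1,3)])
  have P: "outer v \<in> carrier_mat m m"
    using v by (rule outer_carrier)
  show "1\<^sub>m m - outer v * J \<in> carrier_mat m m"
    using P J by (simp add: minus_carrier_mat)
  show "transpose_mat (1\<^sub>m m - outer v * J) * J * (1\<^sub>m m - outer v * J) = J"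
    by (rule transvection_preserves_form[OF two J(1,2) v])
  have c: "2 \<cdot>\<^sub>m 1\<^sub>m m + outer v * J \<in> carrier_mat m m" "2 \<cdot>\<^sub>m 1\<^sub>m m - outer v * J \<in> carrier_mat m m"
    using P J by (auto intro!: minus_carrier_mat)
  have "(2 * 2 :: 'a) \<noteq> 0"
    using two by (simp only: mult_eq_0_iff simp_thms)
  then have "det ((2 \<cdot>\<^sub>m 1\<^sub>m m + outer v * J) * (2 \<cdot>\<^sub>m 1\<^sub>m m - outer v * J)) \<noteq> 0"
    unfolding transvection_inverse[OF two J(1,2) v] by simp
  then have "det (2 \<cdot>\<^sub>m 1\<^sub>m m - outer v * J) \<noteq> 0"
    by (simp add: det_mult[OF c])
  also have "2 \<cdot>\<^sub>m 1\<^sub>m m - outer v * J = 1\<^sub>m m + (1\<^sub>m m - outer v * J)"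
    using P J by (intro eq_matI) auto
  finally show "det (1\<^sub>m m + (1\<^sub>m m - outer v * J)) \<noteq> 0" .
qed

text \<open>Here \<open>g k = - k\<close>, so invariance of the form gives
  \<open>k^T J x = (g k)^T J (g x) = - k^T J (g x)\<close>. Thus \<open>ker (1 + g)\<close> is
  orthogonal to the range of \<open>1 + g\<close>.\<close>

lemma form_on_kernel_vanishes:
  fixes J :: "'a::comm_ring_1 mat"
  assumes J: "J \<in> carrier_mat m m" and g: "g \<in> carrier_mat m m"
    and eq: "transpose_mat g * J * g = J"
    and k: "k \<in> carrier_vec m" "k + g *\<^sub>v k = 0\<^sub>v m" and x: "x \<in> carrier_vec m"
  shows "k \<bullet> (J *\<^sub>v (x + g *\<^sub>v x)) = 0"
proof -
  have gk: "k = - (g *\<^sub>v k)"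
  proof (rule eq_vecI)
    fix i assume "i < dim_vec (- (g *\<^sub>v k))"
    then show "k $ i = (- (g *\<^sub>v k)) $ i"
      using arg_cong[OF k(2), of "\<lambda>v. v $ i"] k(1) g by (simp add: eq_neg_iff_add_eq_0)
  qed (use k g in simp)
  have "k \<bullet> (J *\<^sub>v x) = k \<bullet> ((transpose_mat g * J * g) *\<^sub>v x)"
    by (simp add: eq)
  also have "\<dots> = k \<bullet> (transpose_mat g *\<^sub>v (J *\<^sub>v (g *\<^sub>v x)))"
    using J g x by (simp add: assoc_mult_mat_vec[of _ m m _ m])
  also have "\<dots> = (g *\<^sub>v k) \<bullet> (J *\<^sub>v (g *\<^sub>v x))"
    using J g x k transpose_vec_mult_scalar[of "transpose_mat g" m m] by simp
  finally have "k \<bullet> (J *\<^sub>v x) = (g *\<^sub>v k) \<bullet> (J *\<^sub>v (g *\<^sub>v x))" .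
  moreover have "k \<bullet> (J *\<^sub>v (g *\<^sub>v x)) = - ((g *\<^sub>v k) \<bullet> (J *\<^sub>v (g *\<^sub>v x)))"
    using J g x k by (subst gk) simp
  ultimately show ?thesis
    using J g x k by (simp add: mult_add_distrib_mat_vec[of _ m m] scalar_prod_add_distrib[of _ m])
qed

text \<open>
  The list \<open>vs\<close> makes the induction possible: if \<open>v\<close> is not orthogonal to \<open>ker (1 + g)\<close>, then
  composing \<open>g\<close> with the transvection along \<open>v\<close> cuts \<open>ker (1 + g)\<close> down to its subspace orthogonal
  to \<open>v\<close>, because \<open>ker (1 + g)\<close> is orthogonal to the range of \<open>1 + g\<close>.
\<close>
lemma det_isometry_if_separated:
  fixes J :: "'a::field mat"
  assumes two: "(2::'a) \<noteq> 0"
    and J: "J \<in> carrier_mat m m" "transpose_mat J = - J" "det J \<noteq> 0"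
    and "set vs \<subseteq> carrier_vec m"
    and "g \<in> carrier_mat m m" "transpose_mat g * J * g = J"
    and "\<And>x. x \<in> carrier_vec m \<Longrightarrow> x + g *\<^sub>v x = 0\<^sub>v m \<Longrightarrow> \<forall>v \<in> set vs. v \<bullet> (J *\<^sub>v x) = 0 \<Longrightarrow> x = 0\<^sub>v m"
  shows "det g = 1"
  using assms(5-)
proof (induction vs arbitrary: g)
  case Nil
  have "(1\<^sub>m m + g) *\<^sub>v x = x + g *\<^sub>v x" if "x \<in> carrier_vec m" for x
    using that Nil(2) by (simp add: add_mult_distrib_mat_vec[of _ m m])
  moreover have "1\<^sub>m m + g \<in> carrier_mat m m"
    using Nil(2) by simp
  ultimately have "det (1\<^sub>m m + g) \<noteq> 0"
    unfolding det_0_iff_vec_prod_zero_field[OF \<open>1\<^sub>m m + g \<in> carrier_mat m m\<close>]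
    using Nil(4) by (metis empty_iff empty_set)
  then show ?case
    using det_isometry_if_add_one_nonsingular[OF J(1,3)] Nil by blast
next
  case (Cons v vs)
  note g = Cons.prems(2,3)
  have v: "v \<in> carrier_vec m" and vs: "set vs \<subseteq> carrier_vec m"
    using Cons.prems(1) by auto
  show ?case
  \<comment> \<open>If \<open>v\<close> is orthogonal to the whole kernel, it separates nothing
    there and \<open>vs\<close> alone suffices for the same \<open>g\<close>. Otherwise
    \<open>g\<close> is replaced by \<open>T * g\<close>.\<close>
  proof (cases "\<exists>k \<in> carrier_vec m. k + g *\<^sub>v k = 0\<^sub>v m \<and> v \<bullet> (J *\<^sub>v k) \<noteq> 0")
    case False
    then show ?thesis
      using Cons.IH[OF vs g] Cons.prems(4) by auto
  next
    case True
    then obtain k where k: "k \<in> carrier_vec m" "k + g *\<^sub>v k = 0\<^sub>v m" "v \<bullet> (J *\<^sub>v k) \<noteq> 0"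
      by blast
    define N where "N = outer v * J"
    have N: "N \<in> carrier_mat m m"
      using outer_carrier[OF v] J by (simp add: N_def)
    have Nx: "N *\<^sub>v x = (v \<bullet> (J *\<^sub>v x)) \<cdot>\<^sub>v v" if "x \<in> carrier_vec m" for x
      using that v J outer_carrier[OF v] by (simp add: N_def assoc_mult_mat_vec[of _ m m _ m] outer_mult_vec[of _ m])
    define T where "T = 1\<^sub>m m - N"
    have T: "T \<in> carrier_mat m m"
      using N by (simp add: T_def minus_carrier_mat)
    have "(1 :: 'a) \<cdot>\<^sub>m 1\<^sub>m m = 1\<^sub>m m"
      by (intro eq_matI) auto
    then have inv: "(1\<^sub>m m + N) * T = 1\<^sub>m m"
      using transvection_inverse[OF two J(1,2) v, of 1] by (simp add: T_def N_def)
    have "transpose_mat (T * g) * J * (T * g) = transpose_mat g * (transpose_mat T * J * T) * g"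
      using T g J by (simp add: transpose_mult[of _ m m _ m] assoc_mult_mat[of _ m m _ m _ m])
    also have "\<dots> = J"
      using transvection_preserves_form[OF two J(1,2) v] g by (simp add: T_def N_def)
    finally have form: "transpose_mat (T * g) * J * (T * g) = J" .
    have "det (T * g) = 1"
    proof (rule Cons.IH[OF vs _ form])
      show "T * g \<in> carrier_mat m m"
        using T g by simp
    next
      fix x assume x: "x \<in> carrier_vec m" "x + (T * g) *\<^sub>v x = 0\<^sub>v m" "\<forall>v \<in> set vs. v \<bullet> (J *\<^sub>v x) = 0"
      have "0\<^sub>v m = (1\<^sub>m m + N) *\<^sub>v (x + (T * g) *\<^sub>v x)"
        unfolding x(2) using N by (intro eq_vecI) auto
      also have "\<dots> = x + N *\<^sub>v x + ((1\<^sub>m m + N) * T) *\<^sub>v (g *\<^sub>v x)"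
        using N T g x(1) by (simp add: mult_add_distrib_mat_vec[of _ m m] assoc_mult_mat_vec[of _ m m _ m] add_mult_distrib_mat_vec[of _ m m])
      also have "\<dots> = (x + g *\<^sub>v x) + (v \<bullet> (J *\<^sub>v x)) \<cdot>\<^sub>v v"
        using N T g x v by (simp add: inv Nx) (intro eq_vecI, auto)
      finally have e: "(x + g *\<^sub>v x) + (v \<bullet> (J *\<^sub>v x)) \<cdot>\<^sub>v v = 0\<^sub>v m" by simp
      have split: "k \<bullet> (J *\<^sub>v (y + c \<cdot>\<^sub>v v)) = k \<bullet> (J *\<^sub>v y) + c * (k \<bullet> (J *\<^sub>v v))"
        if "y \<in> carrier_vec m" for y c
        using k J v that
        by (simp add: mult_add_distrib_mat_vec[of _ m m] scalar_prod_add_distrib[of _ m] mult_mat_vec[of _ m m])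
      have "J *\<^sub>v 0\<^sub>v m = 0\<^sub>v m"
        using J by (intro eq_vecI) auto
      \<comment> \<open>Pairing with \<open>k\<close> kills \<open>x + g x\<close>. What remains is
        the coefficient of \<open>v\<close> times a nonzero number, so that coefficient vanishes and
        \<open>x\<close> lies in \<open>ker (1 + g)\<close>, orthogonal to \<open>v\<close>.\<close>
      then have "0 = k \<bullet> (J *\<^sub>v ((x + g *\<^sub>v x) + (v \<bullet> (J *\<^sub>v x)) \<cdot>\<^sub>v v))"
        unfolding e using k by simp
      also have "\<dots> = k \<bullet> (J *\<^sub>v (x + g *\<^sub>v x)) + (v \<bullet> (J *\<^sub>v x)) * (k \<bullet> (J *\<^sub>v v))"
        by (rule split) (use g x(1) in simp)
      also have "\<dots> = - (v \<bullet> (J *\<^sub>v x)) * (v \<bullet> (J *\<^sub>v k))"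
        by (simp add: form_on_kernel_vanishes[OF J(1) g k(1,2) x(1)] skew_form_swap[OF J(1,2) k(1) v])
      finally have vx: "v \<bullet> (J *\<^sub>v x) = 0"
        using k(3) by simp
      moreover have "0 \<cdot>\<^sub>v v = 0\<^sub>v m"
        using v by (intro eq_vecI) auto
      ultimately have "x + g *\<^sub>v x = 0\<^sub>v m"
        using e g x(1) by simp
      then show "x = 0\<^sub>v m"
        using Cons.prems(4) x vx by simp
    qed
    moreover have "det T = 1"
      using det_transvection[OF two J v] by (simp add: T_def N_def)
    ultimately show ?thesis
      using T g by (simp add: det_mult[of _ m])
  qed
qed

text \<open>The unit vectors separate everything: a vector \<open>x\<close> orthogonal to all of
  them has \<open>J x = 0\<close>, hence \<open>x = 0\<close> as \<open>J\<close> is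
  nonsingular.\<close>

theorem det_isometry_skew_form:
  fixes J :: "'a::field mat"
  assumes two: "(2::'a) \<noteq> 0"
    and J: "J \<in> carrier_mat m m" "transpose_mat J = - J" "det J \<noteq> 0"
    and g: "g \<in> carrier_mat m m" "transpose_mat g * J * g = J"
  shows "det g = 1"
proof (rule det_isometry_if_separated[OF two J _ g, of "unit_vecs m"])
  fix x assume x: "x \<in> carrier_vec m" "\<forall>v \<in> set (unit_vecs m). v \<bullet> (J *\<^sub>v x) = 0"
  have "J *\<^sub>v x = 0\<^sub>v m"
  proof (rule eq_vecI)
    fix i assume "i < dim_vec (0\<^sub>v m :: 'a vec)"
    then have i: "i < m" by simp
    then have "unit_vec m i \<bullet> (J *\<^sub>v x) = 0"
      using x(2) by (simp add: unit_vecs_def)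
    then show "(J *\<^sub>v x) $ i = 0\<^sub>v m $ i"
      using i J x by (simp add: scalar_prod_left_unit[of _ m])
  qed (use J in simp)
  then show "x = 0\<^sub>v m"
    using x J det_0_iff_vec_prod_zero_field[OF J(1)] by blast
qed (simp add: unit_vecs_carrier)

subsection \<open>Pleasant pairs in special linear groups\<close>

text \<open>Two elements act by the same conjugation exactly when they differ by a central factor.
  This replaces the equality of automorphisms in \<open>pleasant\<close> by a condition on elements
  of \<open>G\<close>.\<close>

lemma group_pleasant_iff:
  assumes "group G" and H: "H \<subseteq> carrier G"
  shows "pleasant G H \<theta> \<longleftrightarrow>
    (\<forall>g \<in> carrier G. \<forall>w \<in> group_center G. \<theta> g = g \<otimes>\<^bsub>G\<^esub> w \<longrightarrow>
      (\<exists>z \<in> group_center G. g \<otimes>\<^bsub>G\<^esub> z \<in> H))"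
proof -
  interpret group G by fact
  have Ad_mult_center: "Ad G (g \<otimes>\<^bsub>G\<^esub> z) = Ad G g" if g: "g \<in> carrier G" and z: "z \<in> group_center G" for g z
  proof -
    have zc: "z \<in> carrier G" using z by (simp add: group_center_def)
    have "g \<otimes>\<^bsub>G\<^esub> z \<otimes>\<^bsub>G\<^esub> x \<otimes>\<^bsub>G\<^esub> inv\<^bsub>G\<^esub> (g \<otimes>\<^bsub>G\<^esub> z) = g \<otimes>\<^bsub>G\<^esub> x \<otimes>\<^bsub>G\<^esub> inv\<^bsub>G\<^esub> g" if x: "x \<in> carrier G" for x
    proof -
      have "z \<otimes>\<^bsub>G\<^esub> x = x \<otimes>\<^bsub>G\<^esub> z" using z x by (simp add: group_center_def)
      then have "g \<otimes>\<^bsub>G\<^esub> z \<otimes>\<^bsub>G\<^esub> x = g \<otimes>\<^bsub>G\<^esub> x \<otimes>\<^bsub>G\<^esub> z"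
        using g x zc by (simp add: m_assoc)
      then show ?thesis
        using g x zc by (simp add: inv_mult_group m_assoc) (simp add: m_assoc[symmetric])
    qed
    then show ?thesis by (auto simp: Ad_def)
  qed
  have center_of_Ad: "inv\<^bsub>G\<^esub> g \<otimes>\<^bsub>G\<^esub> h \<in> group_center G"
    if g: "g \<in> carrier G" and h: "h \<in> carrier G" and eq: "Ad G g = Ad G h" for g h
  proof -
    have "inv\<^bsub>G\<^esub> g \<otimes>\<^bsub>G\<^esub> h \<otimes>\<^bsub>G\<^esub> x = x \<otimes>\<^bsub>G\<^esub> (inv\<^bsub>G\<^esub> g \<otimes>\<^bsub>G\<^esub> h)" if x: "x \<in> carrier G" for x
    proof -
      have e: "g \<otimes>\<^bsub>G\<^esub> x \<otimes>\<^bsub>G\<^esub> inv\<^bsub>G\<^esub> g = h \<otimes>\<^bsub>G\<^esub> x \<otimes>\<^bsub>G\<^esub> inv\<^bsub>G\<^esub> h"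
        using fun_cong[OF eq, of x] x by (simp add: Ad_def)
      have "inv\<^bsub>G\<^esub> g \<otimes>\<^bsub>G\<^esub> h \<otimes>\<^bsub>G\<^esub> x = inv\<^bsub>G\<^esub> g \<otimes>\<^bsub>G\<^esub> (h \<otimes>\<^bsub>G\<^esub> x \<otimes>\<^bsub>G\<^esub> inv\<^bsub>G\<^esub> h) \<otimes>\<^bsub>G\<^esub> h"
        using g h x by (simp add: m_assoc)
      also have "\<dots> = x \<otimes>\<^bsub>G\<^esub> (inv\<^bsub>G\<^esub> g \<otimes>\<^bsub>G\<^esub> h)"
        unfolding e[symmetric] using g h x by (simp add: m_assoc[symmetric])
      finally show ?thesis .
    qed
    then show ?thesis using g h by (simp add: group_center_def)
  qed
  show ?thesis
  proof
    assume pl: "pleasant G H \<theta>"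
    show "\<forall>g \<in> carrier G. \<forall>w \<in> group_center G. \<theta> g = g \<otimes>\<^bsub>G\<^esub> w \<longrightarrow>
      (\<exists>z \<in> group_center G. g \<otimes>\<^bsub>G\<^esub> z \<in> H)"
    proof (intro ballI impI)
      fix g w assume g: "g \<in> carrier G" and w: "w \<in> group_center G" "\<theta> g = g \<otimes>\<^bsub>G\<^esub> w"
      then have "g \<in> A_theta G \<theta>" by (auto simp: A_theta_def l_coset_def)
      then obtain h where h: "h \<in> H" "Ad G g = Ad G h"
        using pl unfolding pleasant_def by blast
      then have hc: "h \<in> carrier G" using H by blast
      \<comment> \<open>The central witness is the quotient of \<open>h\<close> by
        \<open>g\<close>.\<close>
      have "g \<otimes>\<^bsub>G\<^esub> (inv\<^bsub>G\<^esub> g \<otimes>\<^bsub>G\<^esub> h) = h" using g hc by (simp add: m_assoc[symmetric])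
      then show "\<exists>z \<in> group_center G. g \<otimes>\<^bsub>G\<^esub> z \<in> H"
        using center_of_Ad[OF g hc h(2)] h(1) by metis
    qed
  next
    assume r: "\<forall>g \<in> carrier G. \<forall>w \<in> group_center G. \<theta> g = g \<otimes>\<^bsub>G\<^esub> w \<longrightarrow>
      (\<exists>z \<in> group_center G. g \<otimes>\<^bsub>G\<^esub> z \<in> H)"
    show "pleasant G H \<theta>"
      unfolding pleasant_def
    proof
      fix f assume "f \<in> Ad G ` A_theta G \<theta>"
      then obtain g w where "f = Ad G g" "g \<in> carrier G" "w \<in> group_center G" "\<theta> g = g \<otimes>\<^bsub>G\<^esub> w"
        by (auto simp: A_theta_def l_coset_def)
      then show "f \<in> Ad G ` H"
        using r Ad_mult_center by (metis imageI)
    qed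
  qed
qed

lemma symmetric_pairI:
  assumes "group G" and cl: "\<And>g. g \<in> carrier G \<Longrightarrow> \<theta> g \<in> carrier G"
    and hom: "\<And>g h. g \<in> carrier G \<Longrightarrow> h \<in> carrier G \<Longrightarrow> \<theta> (g \<otimes>\<^bsub>G\<^esub> h) = \<theta> g \<otimes>\<^bsub>G\<^esub> \<theta> h"
    and inv: "\<And>g. g \<in> carrier G \<Longrightarrow> \<theta> (\<theta> g) = g"
    and "H = {g \<in> carrier G. \<theta> g = g}"
  shows "symmetric_pair G H \<theta>"
proof -
  have "bij_betw \<theta> (carrier G) (carrier G)"
    by (rule bij_betwI[of _ _ _ \<theta>]) (auto simp: cl inv)
  then show ?thesis
    using assms by (auto simp: symmetric_pair_def is_involution_def iso_def hom_def)
qed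

section \<open>The groups \<open>GL\<close> and \<open>SL\<close> and the centre of
  \<open>SL\<close>\<close>

lemma carrier_GL: "g \<in> carrier (GL m) \<longleftrightarrow> g \<in> carrier_mat m m \<and> det g \<noteq> 0"
  using det_non_zero_imp_unit[of g m "()"] unit_imp_det_non_zero[of g m "()"]
  by (auto simp: GL_def units_of_carrier Units_def ring_mat_def)

lemma GL_mult [simp]: "g \<otimes>\<^bsub>GL m\<^esub> h = g * h" and GL_one [simp]: "\<one>\<^bsub>GL m\<^esub> = 1\<^sub>m m"
  by (simp_all add: GL_def units_of_mult units_of_one ring_mat_simps)

lemma group_GL: "group (GL m)"
  unfolding GL_def
  by (intro monoid.units_group semiring.axioms(2) semiring_mat)

lemma inv_GL:
  assumes "g \<in> carrier (GL m)"
  shows "inv\<^bsub>GL m\<^esub> g \<in> carrier_mat m m" "g * inv\<^bsub>GL m\<^esub> g = 1\<^sub>m m" "inv\<^bsub>GL m\<^esub> g * g = 1\<^sub>m m"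
  using group.inv_closed[OF group_GL assms] group.r_inv[OF group_GL assms] group.l_inv[OF group_GL assms]
  by (auto simp: carrier_GL)

lemma carrier_SL: "g \<in> carrier (SL m) \<longleftrightarrow> g \<in> carrier_mat m m \<and> det g = 1"
  by (auto simp: SL_def carrier_GL)

lemma SL_D:
  assumes "g \<in> carrier (SL m)"
  shows "g \<in> carrier_mat m m" "det g = 1"
  using assms by (auto simp: carrier_SL)

lemma SL_mult [simp]: "g \<otimes>\<^bsub>SL m\<^esub> h = g * h"
  by (simp add: SL_def)

lemma group_SL: "group (SL m)"
  unfolding SL_def
proof (intro group.subgroup_imp_group group.subgroupI group_GL)
  fix g assume g: "g \<in> {g \<in> carrier (GL m). det g = 1}"
  then have gc: "g \<in> carrier (GL m)" by simp
  have "det g * det (inv\<^bsub>GL m\<^esub> g) = 1"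
    using det_mult[of g m "inv\<^bsub>GL m\<^esub> g"] inv_GL[OF gc] gc by (simp add: carrier_GL)
  then show "inv\<^bsub>GL m\<^esub> g \<in> {g \<in> carrier (GL m). det g = 1}"
    using g group.inv_closed[OF group_GL gc] by simp
next
  have "1\<^sub>m m \<in> {g \<in> carrier (GL m). det g = 1}"
    by (simp add: carrier_GL)
  then show "{g \<in> carrier (GL m). det g = 1} \<noteq> {}" by blast
qed (auto simp: carrier_GL det_mult[of _ m])

text \<open>Commuting with an elementary matrix means that adding column \<open>k\<close> to column
  \<open>l\<close> has the same effect as adding row \<open>l\<close> to row
  \<open>k\<close>.\<close>

lemma commute_addrow_mat_imp_scalar:
  fixes z :: "'a::comm_ring_1 mat"
  assumes z: "z \<in> carrier_mat m m"
    and comm: "\<And>k l. k < m \<Longrightarrow> l < m \<Longrightarrow> k \<noteq> l \<Longrightarrow> z * addrow_mat m 1 k l = addrow_mat m 1 k l * z"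
  shows "\<exists>c. z = c \<cdot>\<^sub>m 1\<^sub>m m"
proof -
  have eq: "addcol 1 l k z = addrow 1 k l z" if "k < m" "l < m" "k \<noteq> l" for k l
    using that comm addcol_mat[OF z \<open>k < m\<close>] addrow_mat[OF z \<open>l < m\<close>] by metis
  \<comment> \<open>The \<open>(k, k)\<close> entries show that \<open>z\<close> is diagonal; the
    \<open>(k, l)\<close> entries then compare two diagonal entries.\<close>
  have off: "z $$ (l, k) = 0" if "k < m" "l < m" "k \<noteq> l" for k l
    using arg_cong[OF eq[OF that], of "\<lambda>A. A $$ (k, k)"] that z by simp
  have diag: "z $$ (k, k) = z $$ (l, l)" if "k < m" "l < m" "k \<noteq> l" for k l
    using arg_cong[OF eq[OF that], of "\<lambda>A. A $$ (k, l)"] that z by (simp add: add.commute)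
  have "z = z $$ (0, 0) \<cdot>\<^sub>m 1\<^sub>m m"
    using z off diag by (intro eq_matI) (auto, metis gr_zeroI less_trans)
  then show ?thesis ..
qed

lemma group_center_SL: "group_center (SL m) = {c \<cdot>\<^sub>m 1\<^sub>m m | c. c ^ m = 1}"
proof (intro equalityI subsetI)
  fix z assume z: "z \<in> group_center (SL m)"
  then have zc: "z \<in> carrier_mat m m" and dz: "det z = 1"
    by (auto simp: group_center_def carrier_SL)
  \<comment> \<open>Elementary matrices have determinant 1, so they lie in \<open>SL m\<close> and a
    central element commutes with them.\<close>
  have "z * addrow_mat m 1 k l = addrow_mat m 1 k l * z" if "k \<noteq> l" for k l
    using z that by (simp add: group_center_def carrier_SL det_addrow_mat)
  then obtain c where "z = c \<cdot>\<^sub>m 1\<^sub>m m"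
    using commute_addrow_mat_imp_scalar[OF zc] by blast
  then show "z \<in> {c \<cdot>\<^sub>m 1\<^sub>m m | c. c ^ m = 1}"
    using dz by auto
next
  fix z :: "complex mat" assume "z \<in> {c \<cdot>\<^sub>m 1\<^sub>m m | c. c ^ m = 1}"
  then obtain c where "z = c \<cdot>\<^sub>m 1\<^sub>m m" "c ^ m = 1" by blast
  then show "z \<in> group_center (SL m)"
    by (auto simp: group_center_def carrier_SL mult_smult_distrib[of _ m m _ m] mult_smult_assoc_mat[of _ m m _ m])
qed

lemma pleasant_SL_iff:
  assumes "H \<subseteq> carrier (SL m)"
  shows "pleasant (SL m) H \<theta> \<longleftrightarrow>
    (\<forall>g \<in> carrier (SL m). \<forall>c. c ^ m = 1 \<longrightarrow> \<theta> g = c \<cdot>\<^sub>m g \<longrightarrow> (\<exists>d. d ^ m = 1 \<and> d \<cdot>\<^sub>m g \<in> H))"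
proof -
  have "g * (c \<cdot>\<^sub>m 1\<^sub>m m) = c \<cdot>\<^sub>m g" if "g \<in> carrier (SL m)" for g c
    using SL_D(1)[OF that] by (simp add: mult_smult_distrib[of _ m m _ m])
  then show ?thesis
    unfolding group_pleasant_iff[OF group_SL assms] group_center_SL by (auto, (metis | blast)+)
qed

text \<open>
  Writing \<open>\<theta>(g)\<close> as the solution \<open>h\<close> of \<open>g\<^sup>T K h = K\<close> treats \<open>SO\<close> (\<open>K = 1\<close>) and \<open>Sp\<close> (\<open>K = J\<close>) together.
\<close>
lemma symmetric_pair_form:
  assumes K: "K \<in> carrier_mat m m" "det K \<noteq> 0" "transpose_mat K = K \<or> transpose_mat K = - K"
    and cl: "\<And>g. g \<in> carrier (SL m) \<Longrightarrow> \<theta> g \<in> carrier_mat m m"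
    and eq: "\<And>g h. g \<in> carrier (SL m) \<Longrightarrow> h \<in> carrier_mat m m \<Longrightarrow>
      \<theta> g = h \<longleftrightarrow> transpose_mat g * K * h = K"
  shows "symmetric_pair (SL m) {g \<in> carrier (SL m). transpose_mat g * K * g = K} \<theta>"
proof (rule symmetric_pairI[OF group_SL])
  have form: "transpose_mat g * K * \<theta> g = K" if "g \<in> carrier (SL m)" for g
    using eq[OF that cl[OF that]] by simp
  show cl': "\<theta> g \<in> carrier (SL m)" if g: "g \<in> carrier (SL m)" for g
  proof -
    \<comment> \<open>Determinants of the defining equation: \<open>det K\<close> cancels and
      \<open>det g = 1\<close>, so \<open>\<theta> g\<close> has determinant 1.\<close>
    have "det (transpose_mat g * K * \<theta> g) = det K"
      by (simp add: form[OF g])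
    then show ?thesis
      using SL_D[OF g] cl[OF g] K by (simp add: carrier_SL det_mult[of _ m] det_transpose[of _ m])
  qed
  show "\<theta> (g \<otimes>\<^bsub>SL m\<^esub> h) = \<theta> g \<otimes>\<^bsub>SL m\<^esub> \<theta> h" if g: "g \<in> carrier (SL m)" and h: "h \<in> carrier (SL m)" for g h
  proof -
    have c: "g \<in> carrier_mat m m" "h \<in> carrier_mat m m" "\<theta> g \<in> carrier_mat m m" "\<theta> h \<in> carrier_mat m m"
      using g h cl by (auto simp: carrier_SL)
    \<comment> \<open>The product \<open>\<theta> g * \<theta> h\<close> solves the equation that
      characterises \<open>\<theta> (g * h)\<close>.\<close>
    have "transpose_mat (g * h) * K * (\<theta> g * \<theta> h) = transpose_mat h * (transpose_mat g * K * \<theta> g) * \<theta> h"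
      using c K by (simp add: transpose_mult[of _ m m _ m] assoc_mult_mat[of _ m m _ m _ m])
    also have "\<dots> = K"
      by (simp add: form g h)
    finally show ?thesis
      using eq[of "g * h" "\<theta> g * \<theta> h"] g h c by (simp add: carrier_SL det_mult[of _ m])
  qed
  show "\<theta> (\<theta> g) = g" if g: "g \<in> carrier (SL m)" for g
  proof -
    have c: "g \<in> carrier_mat m m" "\<theta> g \<in> carrier_mat m m"
      using g cl by (auto simp: carrier_SL)
    \<comment> \<open>Transposing exchanges the roles of \<open>g\<close> and
      \<open>\<theta> g\<close>. Replacing the transpose of \<open>K\<close> by \<open>K\<close> or
      \<open>- K\<close> changes both sides by the same sign, so \<open>g\<close> solves the
      equation for \<open>\<theta> (\<theta> g)\<close>.\<close>
    have "transpose_mat (transpose_mat g * K * \<theta> g) = transpose_mat K"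
      by (simp add: form[OF g])
    then have "transpose_mat (\<theta> g) * (transpose_mat K * g) = transpose_mat K"
      using c K by (simp add: transpose_mult[of _ m m _ m] assoc_mult_mat[of _ m m _ m _ m])
    then have "transpose_mat (\<theta> g) * (K * g) = K"
      using K(1,3) c by auto
    then show ?thesis
      using eq[OF cl'[OF g], of g] c K(1) by (simp add: assoc_mult_mat[of _ m m _ m _ m])
  qed
  show "{g \<in> carrier (SL m). transpose_mat g * K * g = K} = {g \<in> carrier (SL m). \<theta> g = g}"
    using eq by (auto simp: carrier_SL)
qed

section \<open>The orthogonal pairs\<close>

lemma transpose_SL_carrier: "g \<in> carrier (SL m) \<Longrightarrow> transpose_mat g \<in> carrier (GL m)"
  by (simp add: carrier_SL carrier_GL det_transpose[of _ m])

lemma theta_SO_carrier: "g \<in> carrier (SL m) \<Longrightarrow> theta_SO m g \<in> carrier_mat m m"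
  by (simp add: theta_SO_def inv_GL transpose_SL_carrier)

lemma mat_solve_left:
  fixes A :: "'a::semiring_1 mat"
  assumes c: "A \<in> carrier_mat m m" "B \<in> carrier_mat m m" "X \<in> carrier_mat m n" "Y \<in> carrier_mat m n"
    and inv: "A * B = 1\<^sub>m m" "B * A = 1\<^sub>m m"
  shows "B * Y = X \<longleftrightarrow> A * X = Y"
proof
  assume "B * Y = X"
  then have "A * X = (A * B) * Y"
    using c by (metis assoc_mult_mat)
  then show "A * X = Y" using inv c by simp
next
  assume "A * X = Y"
  then have "B * Y = (B * A) * X"
    using c by (metis assoc_mult_mat)
  then show "B * Y = X" using inv c by simp
qed

lemma theta_SO_eq_iff:
  assumes g: "g \<in> carrier (SL m)" and h: "h \<in> carrier_mat m m"
  shows "theta_SO m g = h \<longleftrightarrow> transpose_mat g * 1\<^sub>m m * h = 1\<^sub>m m"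
  using mat_solve_left[of "transpose_mat g" m "inv\<^bsub>GL m\<^esub> (transpose_mat g)" h m "1\<^sub>m m"]
    inv_GL[OF transpose_SL_carrier[OF g]] SL_D(1)[OF g] h
  by (simp add: theta_SO_def)

lemma SO_eq: "SO m = {g \<in> carrier (SL m). transpose_mat g * 1\<^sub>m m * g = 1\<^sub>m m}"
  by (auto simp: SO_def carrier_SL)

lemma symmetric_pair_SO: "symmetric_pair (SL m) (SO m) (theta_SO m)"
  unfolding SO_eq by (rule symmetric_pair_form) (simp_all add: theta_SO_eq_iff theta_SO_carrier)

lemma transpose_smult_mat: "transpose_mat (c \<cdot>\<^sub>m A) = c \<cdot>\<^sub>m transpose_mat A"
  by (rule eq_matI) auto

text \<open>Together these give the condition on \<open>d\<close>: if
  \<open>\<theta>(g) = c g\<close>, the second identity reads \<open>c (g^T K g) = K\<close>, and by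
  the first one \<open>d g\<close> preserves \<open>K\<close> as soon as
  \<open>d^2 = c\<close>.\<close>

lemma form_smult:
  fixes K :: "'a::comm_ring_1 mat"
  assumes "K \<in> carrier_mat m m" "g \<in> carrier_mat m m"
  shows "transpose_mat (d \<cdot>\<^sub>m g) * K * (d \<cdot>\<^sub>m g) = d\<^sup>2 \<cdot>\<^sub>m (transpose_mat g * K * g)"
    and "transpose_mat g * K * (d \<cdot>\<^sub>m g) = d \<cdot>\<^sub>m (transpose_mat g * K * g)"
  using assms
  by (simp_all add: transpose_smult_mat mult_smult_distrib[of _ m m _ m] mult_smult_assoc_mat[of _ m m _ m])
    (auto simp: power2_eq_square)

lemma smult_carrier_SL: "g \<in> carrier (SL m) \<Longrightarrow> d ^ m = 1 \<Longrightarrow> d \<cdot>\<^sub>m g \<in> carrier (SL m)"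
  by (auto simp: carrier_SL)

lemma pleasant_SO_odd: "pleasant (SL (2 * n + 1)) (SO (2 * n + 1)) (theta_SO (2 * n + 1))"
proof -
  define m where "m = 2 * n + 1"
  have "pleasant (SL m) (SO m) (theta_SO m)"
  proof (subst pleasant_SL_iff, safe)
    fix g :: "complex mat" and c :: complex
    assume g: "g \<in> carrier (SL m)" and c: "c ^ m = 1" and eq: "theta_SO m g = c \<cdot>\<^sub>m g"
    have gm: "g \<in> carrier_mat m m" using g by (simp add: carrier_SL)
    \<comment> \<open>A square root of \<open>c\<close> among the \<open>m\<close>-th roots of
      unity: \<open>d^2 = c^(2n+2) = c^m c = c\<close>.\<close>
    define d where "d = c ^ (n + 1)"
    have "d\<^sup>2 = c ^ m * c"
      by (simp add: d_def m_def power_mult[symmetric] power_add mult.commute flip: power_Suc)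
    then have d2: "d\<^sup>2 = c" by (simp add: c)
    have dm: "d ^ m = 1"
      by (metis c d_def mult.commute power_mult power_one)
    have "transpose_mat g * 1\<^sub>m m * (c \<cdot>\<^sub>m g) = 1\<^sub>m m"
      using eq theta_SO_eq_iff[OF g, of "c \<cdot>\<^sub>m g"] gm by auto
    then have "transpose_mat (d \<cdot>\<^sub>m g) * 1\<^sub>m m * (d \<cdot>\<^sub>m g) = 1\<^sub>m m"
      by (simp only: form_smult[OF one_carrier_mat gm] d2)
    then have "d \<cdot>\<^sub>m g \<in> SO m"
      using smult_carrier_SL[OF g dm] by (simp add: SO_eq)
    then show "\<exists>d. d ^ m = 1 \<and> d \<cdot>\<^sub>m g \<in> SO m" using dm by blast
  qed (simp add: SO_eq)
  then show ?thesis by (simp add: m_def)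
qed

lemma not_pleasant_SO_even:
  assumes n: "n \<ge> 1"
  shows "\<not> pleasant (SL (2 * n)) (SO (2 * n)) (theta_SO (2 * n))"
proof -
  define m where "m = 2 * n"
  have m: "m > 0" using n by (simp add: m_def)
  \<comment> \<open>A primitive \<open>2m\<close>-th root of unity; \<open>s^m = -1\<close>
    compensates \<open>det D = -1\<close> below, so that \<open>s D\<close> lies in
    \<open>SL m\<close>.\<close>
  define s where "s = cis (pi / real m)"
  have "s ^ m = cis pi"
    using m by (simp add: s_def DeMoivre)
  then have sm: "s ^ m = -1" by simp
  have s0: "s \<noteq> 0" by (simp add: s_def)
  \<comment> \<open>The reflection \<open>diag(-1, 1, ..., 1)\<close>, which is orthogonal.\<close>
  define D :: "complex mat" where "D = multrow_mat m 0 (-1)"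
  have D: "D \<in> carrier_mat m m" by (simp add: D_def)
  have "transpose_mat D * D = D * D"
    by (rule arg_cong[of _ _ "\<lambda>A. A * D"], rule eq_matI) (auto simp: D_def)
  also have "\<dots> = multrow 0 (-1) D"
    using multrow_mat[OF D, of 0 "-1"] by (simp add: D_def)
  also have "\<dots> = 1\<^sub>m m"
    by (rule eq_matI) (auto simp: D_def)
  finally have DD: "transpose_mat D * 1\<^sub>m m * D = 1\<^sub>m m"
    using D by simp
  have detD: "det D = -1" using m by (simp add: D_def det_multrow_mat)
  define g where "g = s \<cdot>\<^sub>m D"
  have g: "g \<in> carrier (SL m)"
    using D sm detD by (simp add: g_def carrier_SL)
  then have gm: "g \<in> carrier_mat m m" by (simp add: carrier_SL)
  \<comment> \<open>As \<open>g^T g = s^2\<close>, the inverse transpose of \<open>g\<close> is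
    \<open>s^(-2) g\<close>.\<close>
  define c where "c = inverse (s\<^sup>2)"
  have form: "transpose_mat g * 1\<^sub>m m * g = s\<^sup>2 \<cdot>\<^sub>m 1\<^sub>m m"
    using form_smult(1)[OF _ D, of "1\<^sub>m m" s] DD by (simp add: g_def)
  have cm: "c ^ m = 1"
    by (metis c_def inverse_1 mult.commute power2_minus power_inverse power_mult power_one sm)
  have "transpose_mat g * 1\<^sub>m m * (c \<cdot>\<^sub>m g) = 1\<^sub>m m"
    using form_smult(2)[OF _ gm, of "1\<^sub>m m" c] s0 by (simp add: form c_def) (intro eq_matI, auto)
  then have "theta_SO m g = c \<cdot>\<^sub>m g"
    using theta_SO_eq_iff[OF g] gm by simp
  moreover have "d \<cdot>\<^sub>m g \<notin> SO m" if dm: "d ^ m = 1" for d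
  proof
    assume "d \<cdot>\<^sub>m g \<in> SO m"
    then have "d\<^sup>2 \<cdot>\<^sub>m (s\<^sup>2 \<cdot>\<^sub>m 1\<^sub>m m) = 1\<^sub>m m"
      using form_smult(1)[OF _ gm, of "1\<^sub>m m" d] form by (simp add: SO_eq)
    \<comment> \<open>The \<open>(0, 0)\<close> entry exists because \<open>m > 0\<close>. As
      \<open>m\<close> is even, \<open>(d s)^2 = 1\<close> gives \<open>(d s)^m = 1\<close>, against
      \<open>d^m s^m = -1\<close>.\<close>
    from arg_cong[OF this, of "\<lambda>A. A $$ (0, 0)"] have "(d * s)\<^sup>2 = 1"
      using m by (simp add: power_mult_distrib)
    then have "(d * s) ^ m = 1"
      by (simp add: m_def power_mult)
    then show False
      using dm sm by (simp add: power_mult_distrib)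
  qed
  ultimately have "\<not> pleasant (SL m) (SO m) (theta_SO m)"
    using g cm by (subst pleasant_SL_iff) (auto simp: SO_eq)
  then show ?thesis by (simp add: m_def)
qed

subsection \<open>The symplectic pair\<close>

lemma J_mat_carrier: "J_mat n \<in> carrier_mat (2 * n) (2 * n)"
  using four_block_carrier_mat[of "0\<^sub>m n n" n n "0\<^sub>m n n" n n] by (simp add: J_mat_def mult_2)

lemma transpose_J_mat: "transpose_mat (J_mat n) = - J_mat n"
  by (rule eq_matI) (auto simp: J_mat_def)

lemma J_mat_square: "J_mat n * J_mat n = - 1\<^sub>m (2 * n)"
proof -
  have "J_mat n * J_mat n = four_block_mat (- 1\<^sub>m n) (0\<^sub>m n n) (0\<^sub>m n n) (- 1\<^sub>m n)"
    unfolding J_mat_def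
    by (subst mult_four_block_mat[of _ n n _ n _ n _ _ n _ n]) auto
  also have "\<dots> = - 1\<^sub>m (2 * n)"
    by (rule eq_matI) auto
  finally show ?thesis .
qed

lemma J_mat_inverse: "J_mat n * (- J_mat n) = 1\<^sub>m (2 * n)" "(- J_mat n) * J_mat n = 1\<^sub>m (2 * n)"
  using J_mat_carrier[of n] J_mat_square[of n] by auto

lemma det_J_mat_nonzero: "det (J_mat n) \<noteq> 0"
  using det_mult[OF J_mat_carrier[of n], of "- J_mat n"] J_mat_carrier[of n]
  by (auto simp: J_mat_inverse)

lemma det_preserves_J_mat:
  assumes "g \<in> carrier_mat (2 * n) (2 * n)" "transpose_mat g * J_mat n * g = J_mat n"
  shows "det g = 1"
  by (rule det_isometry_skew_form[OF _ J_mat_carrier transpose_J_mat det_J_mat_nonzero assms]) simp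

text \<open>The matrix \<open>J\<close> preserves its own form:
  \<open>J^T J J = - J J J = J\<close>.\<close>

lemma det_J_mat: "det (J_mat n) = 1"
  by (rule det_preserves_J_mat[OF J_mat_carrier])
    (use J_mat_carrier[of n] in \<open>simp add: transpose_J_mat J_mat_inverse J_mat_square\<close>)

lemma Sp_eq: "Sp n = {g \<in> carrier (SL (2 * n)). transpose_mat g * J_mat n * g = J_mat n}"
  using det_preserves_J_mat by (auto simp: Sp_def carrier_SL)

lemma inv_GL_eqI:
  assumes "g \<in> carrier_mat m m" "h \<in> carrier_mat m m" "g * h = 1\<^sub>m m"
  shows "inv\<^bsub>GL m\<^esub> g = h"
proof -
  have "det g * det h = 1"
    using det_mult[OF assms(1,2)] assms(3) by simp
  then have c: "g \<in> carrier (GL m)" "h \<in> carrier (GL m)"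
    using assms by (auto simp: carrier_GL)
  have "h * g = 1\<^sub>m m"
    by (rule mat_mult_left_right_inverse[OF assms])
  then show ?thesis
    using group.inv_equality[OF group_GL _ c] by simp
qed

lemma inv_J_mat: "inv\<^bsub>GL (2 * n)\<^esub> (J_mat n) = - J_mat n"
  by (rule inv_GL_eqI) (use J_mat_carrier[of n] J_mat_inverse[of n] in auto)

lemma theta_Sp_carrier: "g \<in> carrier (SL (2 * n)) \<Longrightarrow> theta_Sp n g \<in> carrier_mat (2 * n) (2 * n)"
  using J_mat_carrier[of n] inv_GL(1)[OF transpose_SL_carrier[of g "2 * n"]]
  by (simp add: theta_Sp_def inv_J_mat)

text \<open>With \<open>B\<close> the inverse transpose of \<open>g\<close> and
  \<open>J^(-1) = - J\<close>, the involution sends \<open>g\<close> to \<open>J (- (B J))\<close>.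
  Moving first \<open>J\<close> and then \<open>B\<close> to the other side yields the equation
  required by \<open>symmetric_pair_form\<close> with \<open>K = J\<close>.\<close>

lemma theta_Sp_eq_iff:
  assumes g: "g \<in> carrier (SL (2 * n))" and h: "h \<in> carrier_mat (2 * n) (2 * n)"
  shows "theta_Sp n g = h \<longleftrightarrow> transpose_mat g * J_mat n * h = J_mat n"
proof -
  define A where "A = transpose_mat g"
  define B where "B = inv\<^bsub>GL (2 * n)\<^esub> A"
  note J = J_mat_carrier[of n]
  have A: "A \<in> carrier_mat (2 * n) (2 * n)"
    using SL_D(1)[OF g] by (simp add: A_def)
  have B: "B \<in> carrier_mat (2 * n) (2 * n)" "A * B = 1\<^sub>m (2 * n)" "B * A = 1\<^sub>m (2 * n)"
    using inv_GL[OF transpose_SL_carrier[OF g]] by (simp_all add: A_def B_def)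
  have "theta_Sp n g = J_mat n * (- (B * J_mat n))"
    using J B by (simp add: theta_Sp_def A_def[symmetric] B_def[symmetric] inv_J_mat)
  also have "\<dots> = h \<longleftrightarrow> (- J_mat n) * h = - (B * J_mat n)"
    by (rule mat_solve_left) (use J B h J_mat_inverse[of n] in auto)
  also have "\<dots> \<longleftrightarrow> B * J_mat n = J_mat n * h"
    using J h by (metis uminus_mult_left_mat uminus_uminus_mat carrier_matD)
  also have "\<dots> \<longleftrightarrow> A * (J_mat n * h) = J_mat n"
    by (rule mat_solve_left) (use J A B h in auto)
  also have "\<dots> \<longleftrightarrow> transpose_mat g * J_mat n * h = J_mat n"
    using A J h by (simp add: A_def)
  finally show ?thesis .
qed

lemma symmetric_pair_Sp: "symmetric_pair (SL (2 * n)) (Sp n) (theta_Sp n)"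
  unfolding Sp_eq
  by (rule symmetric_pair_form)
    (simp_all add: theta_Sp_eq_iff theta_Sp_carrier J_mat_carrier transpose_J_mat det_J_mat)

lemma pleasant_Sp: "pleasant (SL (2 * n)) (Sp n) (theta_Sp n)"
proof (subst pleasant_SL_iff, safe)
  fix g :: "complex mat" and c :: complex
  assume g: "g \<in> carrier (SL (2 * n))" and c: "c ^ (2 * n) = 1" and eq: "theta_Sp n g = c \<cdot>\<^sub>m g"
  note gm = SL_D(1)[OF g]
  \<comment> \<open>Either square root would do: that \<open>d\<close> is a \<open>2n\<close>-th
    root of unity follows below from \<open>det (d g) = 1\<close> and
    \<open>det g = 1\<close>.\<close>
  define d where "d = csqrt c"
  have d2: "d\<^sup>2 = c" by (simp add: d_def)
  have dg: "d \<cdot>\<^sub>m g \<in> carrier_mat (2 * n) (2 * n)" using gm by simp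
  have "transpose_mat g * J_mat n * (c \<cdot>\<^sub>m g) = J_mat n"
    using eq theta_Sp_eq_iff[OF g, of "c \<cdot>\<^sub>m g"] gm by auto
  then have form: "transpose_mat (d \<cdot>\<^sub>m g) * J_mat n * (d \<cdot>\<^sub>m g) = J_mat n"
    by (simp only: form_smult[OF J_mat_carrier gm] d2)
  have "det (d \<cdot>\<^sub>m g) = 1"
    by (rule det_preserves_J_mat[OF dg form])
  then have "d ^ (2 * n) = 1"
    using gm SL_D(2)[OF g] by simp
  moreover have "d \<cdot>\<^sub>m g \<in> Sp n"
    using dg form by (simp add: Sp_def)
  ultimately show "\<exists>d. d ^ (2 * n) = 1 \<and> d \<cdot>\<^sub>m g \<in> Sp n" by blast
qed (simp add: Sp_eq)

subsection \<open>The pair of block diagonal matrices\<close>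

lemma I_mat_carrier: "I_mat p q \<in> carrier_mat (p + q) (p + q)"
  by (simp add: I_mat_def)

lemma I_mat_index:
  "i < p + q \<Longrightarrow> j < p + q \<Longrightarrow> I_mat p q $$ (i, j) = (if i = j then if i < p then 1 else - 1 else 0)"
  by (auto simp: I_mat_def)

lemma I_mat_square: "I_mat p q * I_mat p q = 1\<^sub>m (p + q)"
proof -
  have [simp]: "- 0\<^sub>m p q = (0\<^sub>m p q :: complex mat)"
    by (rule eq_matI) auto
  show ?thesis
    unfolding I_mat_def by (subst mult_four_block_mat[of _ p p _ q _ q _ _ p _ q]) auto
qed

lemma theta_GL_GL_eq: "theta_GL_GL p q g = I_mat p q * g * I_mat p q"
  using inv_GL_eqI[OF I_mat_carrier I_mat_carrier I_mat_square] by (simp add: theta_GL_GL_def)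

text \<open>Since \<open>I_mat p q\<close> is diagonal with signs \<open>s i\<close>, conjugation
  multiplies the \<open>(i, j)\<close> entry by \<open>s i * s j\<close>: the diagonal blocks stay
  and the other two change sign.\<close>

lemma theta_GL_GL_index:
  assumes "g \<in> carrier_mat (p + q) (p + q)" and ij: "i < p + q" "j < p + q"
  shows "theta_GL_GL p q g $$ (i, j) = (if (i < p) = (j < p) then g $$ (i, j) else - g $$ (i, j))"
proof -
  define s :: "nat \<Rightarrow> complex" where "s k = (if k < p then 1 else -1)" for k
  have I: "I_mat p q = mat (p + q) (p + q) (\<lambda>(i, j). if i = j then s i else 0)"
    using I_mat_carrier[of p q] by (intro eq_matI) (auto simp: I_mat_index s_def)
  have left: "(I_mat p q * X) $$ (i, j) = s i * X $$ (i, j)" if "X \<in> carrier_mat (p + q) (p + q)" for X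
    using that ij by (simp add: I scalar_prod_def if_distrib[of "\<lambda>x. x * _"] cong: if_cong)
  have right: "(X * I_mat p q) $$ (i, j) = X $$ (i, j) * s j" if "X \<in> carrier_mat (p + q) (p + q)" for X
    using that ij by (simp add: I scalar_prod_def if_distrib[of "\<lambda>x. _ * x"] cong: if_cong)
  have "(I_mat p q * g * I_mat p q) $$ (i, j) = s i * g $$ (i, j) * s j"
    unfolding right[OF mult_carrier_mat[OF I_mat_carrier assms(1)]] left[OF assms(1)] ..
  then show ?thesis by (auto simp: theta_GL_GL_eq s_def)
qed

lemma theta_GL_GL_carrier:
  "g \<in> carrier_mat (p + q) (p + q) \<Longrightarrow> theta_GL_GL p q g \<in> carrier_mat (p + q) (p + q)"
  using I_mat_carrier[of p q] by (simp add: theta_GL_GL_eq)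

lemma S_GL_GL_eq: "S_GL_GL p q = {g \<in> carrier (SL (p + q)). theta_GL_GL p q g = g}"
proof (intro equalityI subsetI)
  fix g assume "g \<in> S_GL_GL p q"
  then obtain a b where g: "g = four_block_mat a (0\<^sub>m p q) (0\<^sub>m q p) b"
    and a: "a \<in> carrier_mat p p" and b: "b \<in> carrier_mat q q" and ab: "det a * det b = 1"
    by (auto simp: S_GL_GL_def carrier_GL)
  have gm: "g \<in> carrier_mat (p + q) (p + q)"
    unfolding g by (rule four_block_carrier_mat[OF a b])
  have "det g = 1"
    unfolding g by (subst det_four_block_mat_upper_right_zero[OF a refl _ b]) (simp_all add: ab)
  moreover have "theta_GL_GL p q g = g"
  proof (rule eq_matI)
    fix i j assume "i < dim_row g" "j < dim_col g"
    then have ij: "i < p + q" "j < p + q" using gm by auto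
    then show "theta_GL_GL p q g $$ (i, j) = g $$ (i, j)"
      unfolding theta_GL_GL_index[OF gm ij] using a b by (auto simp: g)
  qed (use gm theta_GL_GL_carrier[OF gm] in auto)
  ultimately show "g \<in> {g \<in> carrier (SL (p + q)). theta_GL_GL p q g = g}"
    using gm by (simp add: carrier_SL)
next
  fix g assume "g \<in> {g \<in> carrier (SL (p + q)). theta_GL_GL p q g = g}"
  then have gm: "g \<in> carrier_mat (p + q) (p + q)" and dg: "det g = 1" and fix_g: "theta_GL_GL p q g = g"
    using SL_D by auto
  define a where "a = mat p p (\<lambda>(i, j). g $$ (i, j))"
  define b where "b = mat q q (\<lambda>(i, j). g $$ (i + p, j + p))"
  \<comment> \<open>An entry outside the diagonal blocks of a fixed matrix equals its own
    negative.\<close>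
  have off: "g $$ (i, j) = 0" if "i < p + q" "j < p + q" "(i < p) \<noteq> (j < p)" for i j
    using theta_GL_GL_index[OF gm that(1,2)] that(3) by (simp add: fix_g)
  have g: "g = four_block_mat a (0\<^sub>m p q) (0\<^sub>m q p) b"
    using gm off by (intro eq_matI) (auto simp: a_def b_def)
  have a: "a \<in> carrier_mat p p" and b: "b \<in> carrier_mat q q"
    by (simp_all add: a_def b_def)
  have "det a * det b = 1"
    using dg unfolding g by (subst (asm) det_four_block_mat_upper_right_zero[OF a refl _ b]) simp_all
  moreover from this have "det a \<noteq> 0" "det b \<noteq> 0" by auto
  ultimately show "g \<in> S_GL_GL p q"
    using g a b by (auto simp: S_GL_GL_def carrier_GL)
qed

lemma symmetric_pair_GL_GL: "symmetric_pair (SL (p + q)) (S_GL_GL p q) (theta_GL_GL p q)"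
proof (rule symmetric_pairI[OF group_SL _ _ _ S_GL_GL_eq])
  note I = I_mat_carrier[of p q]
  note [simp] = assoc_mult_mat[of _ "p + q" "p + q" _ "p + q" _ "p + q"]
  have II: "I_mat p q * (I_mat p q * g) = g" if "g \<in> carrier_mat (p + q) (p + q)" for g
  proof -
    have "I_mat p q * (I_mat p q * g) = (I_mat p q * I_mat p q) * g"
      using that I by simp
    then show ?thesis unfolding I_mat_square using that by simp
  qed
  have detI: "det (I_mat p q) * det (I_mat p q) = 1"
    using det_mult[OF I I] by (simp add: I_mat_square)
  fix g assume g: "g \<in> carrier (SL (p + q))"
  note gm = SL_D[OF g]
  show "theta_GL_GL p q g \<in> carrier (SL (p + q))"
    unfolding carrier_SL theta_GL_GL_eq using I gm detI
    by (simp add: det_mult[of _ "p + q"])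
  show "theta_GL_GL p q (theta_GL_GL p q g) = g"
    unfolding theta_GL_GL_eq using I gm(1) by (simp add: II I_mat_square)
  fix h assume h: "h \<in> carrier (SL (p + q))"
  show "theta_GL_GL p q (g \<otimes>\<^bsub>SL (p + q)\<^esub> h) = theta_GL_GL p q g \<otimes>\<^bsub>SL (p + q)\<^esub> theta_GL_GL p q h"
    unfolding theta_GL_GL_eq using I gm(1) SL_D(1)[OF h] by (simp add: II)
qed

lemma trace_mult_commute:
  fixes A B :: "'a::comm_semiring_0 mat"
  assumes "A \<in> carrier_mat m n" "B \<in> carrier_mat n m"
  shows "(\<Sum>i<m. (A * B) $$ (i, i)) = (\<Sum>i<n. (B * A) $$ (i, i))"
proof -
  have "(\<Sum>i<m. (A * B) $$ (i, i)) = (\<Sum>i<m. \<Sum>j<n. A $$ (i, j) * B $$ (j, i))"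
    using assms by (simp add: scalar_prod_def lessThan_atLeast0)
  also have "\<dots> = (\<Sum>j<n. \<Sum>i<m. B $$ (j, i) * A $$ (i, j))"
    by (subst sum.swap) (simp add: mult.commute)
  also have "\<dots> = (\<Sum>i<n. (B * A) $$ (i, i))"
    using assms by (simp add: scalar_prod_def lessThan_atLeast0)
  finally show ?thesis .
qed

lemma trace_I_mat: "(\<Sum>i<p + q. I_mat p q $$ (i, i)) = of_nat p - of_nat q"
proof -
  have "{..<p + q} \<inter> {i. i < p} = {..<p}" "{..<p + q} \<inter> - {i. i < p} = {p..<p + q}"
    by auto
  then show ?thesis
    by (simp add: I_mat_index sum.If_cases)
qed

lemma pleasant_GL_GL:
  assumes "p \<noteq> q"
  shows "pleasant (SL (p + q)) (S_GL_GL p q) (theta_GL_GL p q)"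
proof (subst pleasant_SL_iff, safe)
  note I = I_mat_carrier[of p q]
  fix g :: "complex mat" and c :: complex
  assume g: "g \<in> carrier (SL (p + q))" and eq: "theta_GL_GL p q g = c \<cdot>\<^sub>m g"
  have gG: "g \<in> carrier (GL (p + q))" using g by (simp add: carrier_SL carrier_GL)
  note gm = SL_D(1)[OF g]
  define h where "h = inv\<^bsub>GL (p + q)\<^esub> g"
  note h = inv_GL[OF gG, folded h_def]
  note [simp] = assoc_mult_mat[of _ "p + q" "p + q" _ "p + q" _ "p + q"]
  \<comment> \<open>Inserting \<open>I^2 = 1\<close> on the left makes
    \<open>I g I = \<theta>(g) = c g\<close> appear, and the relation becomes
    \<open>g I g^(-1) = c I\<close>.\<close>
  have "g * (I_mat p q * h) = (I_mat p q * I_mat p q) * g * (I_mat p q * h)"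
    unfolding I_mat_square using gm by simp
  also have "\<dots> = I_mat p q * theta_GL_GL p q g * h"
    using I gm h(1) by (simp add: theta_GL_GL_eq)
  also have "\<dots> = c \<cdot>\<^sub>m I_mat p q"
    unfolding eq using I gm h
    by (simp add: mult_smult_distrib[of _ "p + q" "p + q" _ "p + q"] mult_smult_assoc_mat[of _ "p + q" "p + q" _ "p + q"])
  finally have conj: "g * (I_mat p q * h) = c \<cdot>\<^sub>m I_mat p q" .
  have "I_mat p q * h * g = I_mat p q"
    using I gm h by simp
  \<comment> \<open>Conjugate matrices have equal trace, so
    \<open>c (p - q) = p - q\<close>.\<close>
  then have "(\<Sum>i<p + q. (c \<cdot>\<^sub>m I_mat p q) $$ (i, i)) = (\<Sum>i<p + q. I_mat p q $$ (i, i))"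
    using trace_mult_commute[OF gm, of "I_mat p q * h"] I h(1) by (simp add: conj)
  then have "c * (of_nat p - of_nat q) = of_nat p - of_nat q"
    using I by (simp add: trace_I_mat sum_distrib_left[symmetric])
  then have "c = 1"
    using assms by simp
  moreover have "1 \<cdot>\<^sub>m g = g"
    by (rule eq_matI) auto
  ultimately have "1 \<cdot>\<^sub>m g \<in> S_GL_GL p q"
    using g eq by (simp add: S_GL_GL_eq)
  then show "\<exists>d. d ^ (p + q) = 1 \<and> d \<cdot>\<^sub>m g \<in> S_GL_GL p q"
    by (metis power_one)
qed (simp add: S_GL_GL_eq)

text \<open>For blocks of equal size, \<open>J_mat p\<close> has determinant 1 and zero diagonal
  blocks. It is negated by the involution, and no nonzero multiple of it is fixed.\<close>

lemma not_pleasant_GL_GL: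
  assumes "p \<ge> 1"
  shows "\<not> pleasant (SL (p + p)) (S_GL_GL p p) (theta_GL_GL p p)"
proof -
  have J: "J_mat p \<in> carrier (SL (p + p))"
    using J_mat_carrier[of p] det_J_mat[of p] by (simp add: carrier_SL mult_2)
  note Jm = SL_D(1)[OF J]
  have "theta_GL_GL p p (J_mat p) = -1 \<cdot>\<^sub>m J_mat p"
  proof (rule eq_matI)
    fix i j assume "i < dim_row (-1 \<cdot>\<^sub>m J_mat p)" "j < dim_col (-1 \<cdot>\<^sub>m J_mat p)"
    then have ij: "i < p + p" "j < p + p" using Jm by auto
    then show "theta_GL_GL p p (J_mat p) $$ (i, j) = (-1 \<cdot>\<^sub>m J_mat p) $$ (i, j)"
      unfolding theta_GL_GL_index[OF Jm ij] by (auto simp: J_mat_def)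
  qed (use theta_GL_GL_carrier[OF Jm] Jm in auto)
  moreover have "(-1 :: complex) ^ (p + p) = 1"
    by simp
  moreover have "d \<cdot>\<^sub>m J_mat p \<notin> S_GL_GL p p" if "d ^ (p + p) = 1" for d
  proof
    have dJ: "d \<cdot>\<^sub>m J_mat p \<in> carrier_mat (p + p) (p + p)" using Jm by simp
    \<comment> \<open>Position \<open>(p, 0)\<close> is the top left corner of the lower left block
      of \<open>J_mat p\<close>, an identity block that is nonempty because \<open>p\<close> is at
      least 1.\<close>
    have entry: "(d \<cdot>\<^sub>m J_mat p) $$ (p, 0) = d" using assms by (simp add: J_mat_def)
    assume "d \<cdot>\<^sub>m J_mat p \<in> S_GL_GL p p"
    then have "(d \<cdot>\<^sub>m J_mat p) $$ (p, 0) = - (d \<cdot>\<^sub>m J_mat p) $$ (p, 0)"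
      using theta_GL_GL_index[OF dJ, of p 0] assms by (simp add: S_GL_GL_eq)
    then have "d = 0" unfolding entry by simp
    then show False using that assms by (simp add: power_0_left)
  qed
  moreover have "S_GL_GL p p \<subseteq> carrier (SL (p + p))"
    by (auto simp: S_GL_GL_eq)
  ultimately show ?thesis
    using J by (subst pleasant_SL_iff) blast+
qed

theorem proposition4p14:
  shows
    "(\<forall>n::nat. n \<ge> 1 \<longrightarrow>
        (symmetric_pair (SL (2 * n + 1)) (SO (2 * n + 1)) (theta_SO (2 * n + 1)) \<and>
         pleasant (SL (2 * n + 1)) (SO (2 * n + 1)) (theta_SO (2 * n + 1))) \<and>
        (symmetric_pair (SL (2 * n)) (Sp n) (theta_Sp n) \<and>
         pleasant (SL (2 * n)) (Sp n) (theta_Sp n)) \<and>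
        (symmetric_pair (SL (2 * n)) (SO (2 * n)) (theta_SO (2 * n)) \<and>
         \<not> pleasant (SL (2 * n)) (SO (2 * n)) (theta_SO (2 * n)))) \<and>
     (\<forall>p q::nat. p \<ge> 1 \<and> q \<ge> 1 \<longrightarrow>
        symmetric_pair (SL (p + q)) (S_GL_GL p q) (theta_GL_GL p q) \<and>
        (pleasant (SL (p + q)) (S_GL_GL p q) (theta_GL_GL p q) \<longleftrightarrow> p \<noteq> q))"
  using symmetric_pair_SO pleasant_SO_odd symmetric_pair_Sp pleasant_Sp not_pleasant_SO_even
    symmetric_pair_GL_GL pleasant_GL_GL not_pleasant_GL_GL
  by metis

end
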